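(* Let $\varphi_1,\varphi_2\in\Phi$, let $K,L\in\mathcal{S}_o^n$ and let $k_1,k_2,k$ be positive constants. Then $$\frac{(\varphi_1)'_l(1)}{k_1}\lim_{\varepsilon\to0^+}\frac{k\,V(K\check{+}_{\varphi,\varepsilon}L)-k_1V(K)}{\varepsilon}=\frac1n\int_{S^{n-1}}\varphi_2\!\left(\frac{k_2\,\rho(L,u)^n}{k_1\,\rho(K,u)^n}\right)\rho(K,u)^n\,dS(u).$$
   Context: $\mathcal{S}_o^n$ is the set of star bodies in $\mathbb{R}^n$: compact sets $K\subset\mathbb{R}^n$, star-shaped with respect to the origin, whose radial function $\rho(K,u)=\max\{\lambda\ge 0:\lambda u\in K\}$, $u\in S^{n-1}$, is positive and continuous on $S^{n-1}$. $V$ denotes $n$-dimensional volume and $S$ denotes the spherical Lebesgue (surface area) measure on $S^{n-1}$. $\Phi$ is the set of convex functions $\varphi:[0,\infty)\to[0,\infty)$ that are strictly increasing and satisfy $\varphi(0)=0$ and $\varphi(1)=1$. $(f)'_l$ denotes the left derivative of a real-valued function $f$. For $\varphi_1,\varphi_2\in\Phi$, constants $k_1,k_2,k>0$ and $\varepsilon>0$, the star body $K\check{+}_{\varphi,\varepsilon}L$ (corresponding to $\varphi(x_1,x_2)=\varphi_1(x_1)+\varepsilon\varphi_2(x_2)$) is defined by $$\varphi_1\!\left(\frac{k_1\rho(K,u)^n}{k\,\rho(K\check{+}_{\varphi,\varepsilon}L,u)^n}\right)+\varepsilon\,\varphi_2\!\left(\frac{k_2\rho(L,u)^n}{k\,\rho(K\check{+}_{\varphi,\varepsilon}L,u)^n}\right)=1\qquad\text{for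 all }u\in S^{n-1}.$$ The constants $k,k_1,k_2$ do not depend on $\varepsilon$. *)

theory Defs
  imports "HOL-Analysis.Analysis"
begin

text \<open>The maximum is attained, for every unit vector \<open>u\<close>, when \<open>K\<close> is compact and contains the
  origin.\<close>

definition radial :: "(real ^ 'n::finite) set \<Rightarrow> real ^ 'n \<Rightarrow> real" where
  "radial K u = (GREATEST r. 0 \<le> r \<and> r *\<^sub>R u \<in> K)"

definition star_body :: "(real ^ 'n::finite) set \<Rightarrow> bool" where
  "star_body K \<longleftrightarrow>
     compact K \<and>
     0 \<in> K \<and> (\<forall>x\<in>K. closed_segment 0 x \<subseteq> K) \<and>
     (\<forall>u\<in>sphere 0 1. 0 < radial K u) \<and>
     continuous_on (sphere 0 1) (radial K)"

abbreviation vol :: "(real ^ 'n::finite) set \<Rightarrow> real" where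
  "vol K \<equiv> measure lebesgue K"

text \<open>Spherical Lebesgue measure on the Borel sets of the unit sphere:
  \<open>S(A) = n \<cdot> V({t u | u \<in> A, 0 < t < 1})\<close>.  Since \<open>sgn x = x / norm x\<close>, the cone over \<open>A\<close> is the
  preimage of \<open>A\<close> under \<open>sgn\<close> in the punctured unit ball, see \<open>emeasure_sphere_measure\<close>.\<close>

definition sphere_measure :: "(real ^ 'n::finite) measure" where
  "sphere_measure =
     scale_measure (of_nat CARD('n))
       (distr (restrict_space lborel (ball 0 1 - {0})) (restrict_space borel (sphere 0 1)) sgn)"

lemma emeasure_sphere_measure:
  fixes A :: "(real ^ 'n::finite) set"
  assumes "A \<in> sets borel" "A \<subseteq> sphere 0 1"
  shows "emeasure sphere_measure A =
           of_nat CARD('n) * emeasure lborel {t *\<^sub>R u | t u. u \<in> A \<and> 0 < t \<and> t < 1}"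
proof -
  let ?B = "ball 0 1 - {0} :: (real ^ 'n) set"
  have m0: "sgn \<in> borel_measurable (borel :: (real ^ 'n) measure)"
    unfolding sgn_div_norm[abs_def] by measurable
  have m1: "sgn \<in> restrict_space lborel ?B \<rightarrow>\<^sub>M (borel :: (real ^ 'n) measure)"
    by (rule measurable_restrict_space1) (use m0 in simp)
  have m: "sgn \<in> restrict_space lborel ?B \<rightarrow>\<^sub>M restrict_space borel (sphere 0 1 :: (real ^ 'n) set)"
    by (rule measurable_restrict_space2[OF _ m1]) (auto simp: space_restrict_space norm_sgn)
  have A: "A \<in> sets (restrict_space borel (sphere 0 1))"
    using assms by (auto simp: sets_restrict_space)
  have eq: "sgn -` A \<inter> ?B = {t *\<^sub>R u | t u. u \<in> A \<and> 0 < t \<and> t < 1}"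
  proof (intro equalityI subsetI)
    fix x assume x: "x \<in> sgn -` A \<inter> ?B"
    then have "x = norm x *\<^sub>R sgn x" by (simp add: sgn_div_norm)
    with x show "x \<in> {t *\<^sub>R u | t u. u \<in> A \<and> 0 < t \<and> t < 1}"
      by (auto intro!: exI[of _ "norm x"] exI[of _ "sgn x"])
  next
    fix x assume "x \<in> {t *\<^sub>R u | t u. u \<in> A \<and> 0 < t \<and> t < 1}"
    then obtain t u where tu: "x = t *\<^sub>R u" "u \<in> A" "0 < t" "t < 1" by blast
    with assms have "norm u = 1" by auto
    with tu show "x \<in> sgn -` A \<inter> ?B" by (auto simp: sgn_div_norm)
  qed
  have sub: "{t *\<^sub>R u | t u. u \<in> A \<and> 0 < t \<and> t < 1} \<subseteq> ?B"
    unfolding eq[symmetric] by blast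
  show ?thesis
    unfolding sphere_measure_def
    by (simp add: emeasure_distr[OF m A] space_restrict_space emeasure_restrict_space[OF _ sub] eq)
qed

text \<open>The class \<open>\<Phi>\<close>; values at negative arguments are irrelevant.\<close>

definition orlicz_Phi :: "(real \<Rightarrow> real) set" where
  "orlicz_Phi =
     {\<phi>. \<phi> ` {0..} \<subseteq> {0..} \<and> convex_on {0..} \<phi> \<and> strict_mono_on {0..} \<phi> \<and> \<phi> 0 = 0 \<and> \<phi> 1 = 1}"

definition left_deriv :: "(real \<Rightarrow> real) \<Rightarrow> real \<Rightarrow> real" where
  "left_deriv f x = (THE D. (f has_real_derivative D) (at_left x))"

text \<open>For \<open>\<epsilon> > 0\<close> the left-hand side of the defining equation is strictly decreasing in the radius
  of \<open>M\<close>, so that it determines exactly one star body.\<close>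

definition orlicz_comb ::
  "(real \<Rightarrow> real) \<Rightarrow> (real \<Rightarrow> real) \<Rightarrow> real \<Rightarrow> real \<Rightarrow> real \<Rightarrow> real \<Rightarrow>
   (real ^ 'n::finite) set \<Rightarrow> (real ^ 'n) set \<Rightarrow> (real ^ 'n) set" where
  "orlicz_comb \<phi>1 \<phi>2 k1 k2 k \<epsilon> K L =
     (THE M. star_body M \<and>
        (\<forall>u\<in>sphere 0 1.
           \<phi>1 (k1 * radial K u ^ CARD('n) / (k * radial M u ^ CARD('n))) +
           \<epsilon> * \<phi>2 (k2 * radial L u ^ CARD('n) / (k * radial M u ^ CARD('n))) = 1))"

end

theory Submission
  imports Defs
begin

text \<open>In polar coordinates \<open>vol M\<close> is the integral of \<open>radial M u ^ n / n\<close> over the sphere, so the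
  difference quotient is the integral over \<open>u\<close> of \<open>k1 * radial K u ^ n * (1 / t - 1) / \<epsilon>\<close> divided by
  \<open>n\<close>, where \<open>t\<close> solves \<open>\<phi>1 t + \<epsilon> * \<phi>2 (c * t) = 1\<close> with
  \<open>c = k2 * radial L u ^ n / (k1 * radial K u ^ n)\<close>.  As \<open>\<epsilon>\<close> decreases to \<open>0\<close>, \<open>t\<close> tends to \<open>1\<close> from
  the left and \<open>(1 - t) / \<epsilon> = \<phi>2 (c * t) * (1 - t) / (1 - \<phi>1 t)\<close> tends to \<open>\<phi>2 c\<close> divided by the
  left derivative of \<open>\<phi>1\<close> at \<open>1\<close>.  Convexity bounds \<open>(1 / t - 1) / \<epsilon>\<close> by \<open>\<phi>2 c\<close> for every \<open>\<epsilon> > 0\<close>, so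
  dominated convergence applies.\<close>

subsection \<open>Star bodies and radial functions\<close>

lemma
  assumes "star_body K"
  shows star_body_compact: "compact K"
    and star_body_zero: "0 \<in> K"
    and star_body_segment: "x \<in> K \<Longrightarrow> closed_segment 0 x \<subseteq> K"
    and star_body_radial_pos: "norm u = 1 \<Longrightarrow> 0 < radial K u"
    and star_body_continuous_radial: "continuous_on (sphere 0 1) (radial K)"
  using assms by (auto simp: star_body_def)

text \<open>Compactness makes the set of admissible radii in direction \<open>u\<close> compact, so
  the \<open>GREATEST\<close> in \<open>radial\<close> is a genuine maximum; the segment condition
  then fills in all smaller radii.\<close>

lemma scaleR_mem_star_body_iff:
  fixes K :: "(real ^ 'n::finite) set"
  assumes K: "star_body K" and u: "norm u = 1" and r: "0 \<le> r"
  shows "r *\<^sub>R u \<in> K \<longleftrightarrow> r \<le> radial K u"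
proof -
  define S where "S = {r. 0 \<le> r \<and> r *\<^sub>R u \<in> K}"
  have "S = {0..} \<inter> (\<lambda>r. r *\<^sub>R u) -` K"
    by (auto simp: S_def)
  then have "closed S"
    using compact_imp_closed[OF star_body_compact[OF K]]
    by (simp only:) (intro closed_Int closed_atLeast closed_vimage continuous_intros)
  obtain B where B: "\<And>x. x \<in> K \<Longrightarrow> norm x \<le> B"
    using compact_imp_bounded[OF star_body_compact[OF K]] by (auto simp: bounded_iff)
  have "bounded S"
    unfolding bounded_iff by (rule exI[of _ B]) (use B u in \<open>fastforce simp: S_def\<close>)
  with \<open>closed S\<close> have "compact S"
    by (simp add: compact_eq_bounded_closed)
  moreover have "0 \<in> S"
    using star_body_zero[OF K] by (simp add: S_def)
  ultimately obtain R where R: "R \<in> S" "\<And>r. r \<in> S \<Longrightarrow> r \<le> R"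
    using compact_attains_sup[of S] by blast
  have eq: "radial K u = R"
    unfolding radial_def by (rule Greatest_equality) (use R in \<open>auto simp: S_def\<close>)
  show ?thesis
  proof
    assume "r *\<^sub>R u \<in> K"
    with R r eq show "r \<le> radial K u" by (simp add: S_def)
  next
    assume le: "r \<le> radial K u"
    show "r *\<^sub>R u \<in> K"
    proof (cases "R = 0")
      case True
      with le eq r star_body_zero[OF K] show ?thesis by simp
    next
      case False
      with R have "0 < R" by (auto simp: S_def)
      \<comment> \<open>The point is placed on the segment from the origin to the farthest point of
        \<open>K\<close> in direction \<open>u\<close>.\<close>
      then have "r *\<^sub>R u = (r / R) *\<^sub>R (R *\<^sub>R u)" by simp
      also have "\<dots> \<in> closed_segment 0 (R *\<^sub>R u)"
        unfolding in_segment using r le eq \<open>0 < R\<close> by (intro exI[of _ "r / R"]) auto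
      finally show ?thesis
        using R star_body_segment[OF K, of "R *\<^sub>R u"] by (auto simp: S_def)
    qed
  qed
qed

text \<open>The origin is split off because \<open>sgn 0 = 0\<close> is not a direction and
  \<open>radial K 0\<close> carries no information.\<close>

lemma star_body_eq_radial:
  fixes K :: "(real ^ 'n::finite) set"
  assumes "star_body K"
  shows "K = insert 0 {x. x \<noteq> 0 \<and> norm x \<le> radial K (sgn x)}"
proof -
  have "x \<in> K \<longleftrightarrow> norm x \<le> radial K (sgn x)" if "x \<noteq> 0" for x
    using scaleR_mem_star_body_iff[OF assms, of "sgn x" "norm x"] that
    by (simp add: norm_sgn) (simp add: sgn_div_norm)
  then show ?thesis using star_body_zero[OF assms] by auto
qed

lemma star_body_eqI:
  fixes K L :: "(real ^ 'n::finite) set"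
  assumes "star_body K" "star_body L" "\<And>u. norm u = 1 \<Longrightarrow> radial K u = radial L u"
  shows "K = L"
proof -
  have "radial K (sgn x) = radial L (sgn x)" if "x \<noteq> 0" for x
    using that by (intro assms(3)) (simp add: norm_sgn)
  then have "{x. x \<noteq> 0 \<and> norm x \<le> radial K (sgn x)} = {x. x \<noteq> 0 \<and> norm x \<le> radial L (sgn x)}"
    by auto
  then show ?thesis
    using star_body_eq_radial[OF assms(1)] star_body_eq_radial[OF assms(2)] by metis
qed

text \<open>The body is built as the image of a compact product under a continuous polar map, which
  gives compactness at once. Together with \<open>star_body_eqI\<close> it supplies existence and
  uniqueness for the definite description in \<open>orlicz_comb\<close>.\<close>

lemma star_body_exists:
  fixes \<rho> :: "real ^ 'n::finite \<Rightarrow> real"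
  assumes cont: "continuous_on (sphere 0 1) \<rho>" and pos: "\<And>u. norm u = 1 \<Longrightarrow> 0 < \<rho> u"
  obtains M where "star_body M" "\<And>u. norm u = 1 \<Longrightarrow> radial M u = \<rho> u"
proof -
  define M where "M = (\<lambda>(t, u). (t * \<rho> u) *\<^sub>R u) ` ({0..1} \<times> sphere 0 1)"
  have M_iff: "r *\<^sub>R u \<in> M \<longleftrightarrow> r \<le> \<rho> u" if u: "norm u = 1" and r: "0 \<le> r" for r u
  proof
    assume "r *\<^sub>R u \<in> M"
    then obtain t v where tv: "0 \<le> t" "t \<le> 1" "norm v = 1" "r *\<^sub>R u = (t * \<rho> v) *\<^sub>R v"
      by (auto simp: M_def)
    from pos[OF \<open>norm v = 1\<close>] tv have nn: "0 \<le> t * \<rho> v" by simp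
    from arg_cong[OF tv(4), of norm] u r nn \<open>norm v = 1\<close> have req: "r = t * \<rho> v"
      by simp
    \<comment> \<open>At \<open>r = 0\<close> the equation does not determine the direction
      \<open>v\<close>. Otherwise the common positive factor cancels and gives
      \<open>u = v\<close>.\<close>
    show "r \<le> \<rho> u"
    proof (cases "r = 0")
      case True
      then show ?thesis using pos[OF u] by simp
    next
      case False
      with req tv(4) have "u = v" by simp
      then show ?thesis using req tv(1,2) pos[OF u] by (simp add: mult_left_le_one_le)
    qed
  next
    assume "r \<le> \<rho> u"
    with u r pos[OF u] show "r *\<^sub>R u \<in> M"
      unfolding M_def by (intro image_eqI[of _ _ "(r / \<rho> u, u)"]) auto
  qed
  have rad: "radial M u = \<rho> u" if u: "norm u = 1" for u
    unfolding radial_def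
    by (rule Greatest_equality) (use M_iff[OF u] pos[OF u] in \<open>auto intro: less_imp_le\<close>)
  have "compact M"
    unfolding M_def
  proof (rule compact_continuous_image)
    have "continuous_on ({0..1} \<times> sphere 0 1) (\<lambda>p. \<rho> (snd p) :: real)"
      by (rule continuous_on_compose2[OF cont]) (auto intro!: continuous_intros)
    then show "continuous_on ({0..1} \<times> sphere 0 1) (\<lambda>(t, u). (t * \<rho> u) *\<^sub>R u)"
      unfolding case_prod_beta by (intro continuous_intros)
  qed (intro compact_Times compact_Icc compact_sphere)
  \<comment> \<open>Any unit vector serves as the second coordinate, since the parameter
    \<open>0\<close> annihilates it.\<close>
  moreover have "0 \<in> M"
    unfolding M_def
    by (rule image_eqI[of _ _ "(0, axis undefined 1)"]) auto
  moreover have "closed_segment 0 x \<subseteq> M" if x: "x \<in> M" for x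
  proof
    fix y assume "y \<in> closed_segment 0 x"
    then obtain s where s: "y = s *\<^sub>R x" "0 \<le> s" "s \<le> 1" by (auto simp: in_segment)
    from x obtain t u where tu: "0 \<le> t" "t \<le> 1" "norm u = 1" "x = (t * \<rho> u) *\<^sub>R u"
      by (auto simp: M_def)
    have "y = ((s * t) * \<rho> u) *\<^sub>R u" using s tu by simp
    moreover have "s * t \<le> 1" using s tu by (simp add: mult_le_one)
    ultimately show "y \<in> M"
      unfolding M_def using s tu by (intro image_eqI[of _ _ "(s * t, u)"]) auto
  qed
  moreover have "continuous_on (sphere 0 1) (radial M)"
    using cont by (rule continuous_on_eq) (simp add: rad)
  ultimately have "star_body M"
    using rad pos by (auto simp: star_body_def)
  then show ?thesis using rad by (rule that)
qed

subsection \<open>Orlicz functions\<close>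

lemma orlicz_PhiD:
  assumes "\<phi> \<in> orlicz_Phi"
  shows orlicz_Phi_nonneg: "0 \<le> x \<Longrightarrow> 0 \<le> \<phi> x"
    and orlicz_Phi_convex: "convex_on {0..} \<phi>"
    and orlicz_Phi_less: "0 \<le> x \<Longrightarrow> x < y \<Longrightarrow> \<phi> x < \<phi> y"
    and orlicz_Phi_zero: "\<phi> 0 = 0"
    and orlicz_Phi_one: "\<phi> 1 = 1"
  using assms by (auto simp: orlicz_Phi_def strict_mono_on_def)

lemma orlicz_Phi_mono:
  assumes "\<phi> \<in> orlicz_Phi" "0 \<le> x" "x \<le> y"
  shows "\<phi> x \<le> \<phi> y"
  using orlicz_Phi_less[OF assms(1,2), of y] assms(3) by (cases "x = y") auto

text \<open>Because \<open>\<phi> 0 = 0\<close>, this is convexity along the chord from the origin.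
  It is the source of all later estimates.\<close>

lemma orlicz_Phi_scale_le:
  assumes "\<phi> \<in> orlicz_Phi" "0 \<le> x" "0 \<le> t" "t \<le> 1"
  shows "\<phi> (x * t) \<le> \<phi> x * t"
  using convex_onD[OF orlicz_Phi_convex[OF assms(1)], of t 0 x] assms
  by (simp add: orlicz_Phi_zero[OF assms(1)] mult.commute)

text \<open>Convexity yields continuity only on the open half-line; at the endpoint \<open>0\<close>
  the function is squeezed between \<open>0\<close> and the identity.\<close>

lemma orlicz_Phi_continuous:
  assumes "\<phi> \<in> orlicz_Phi"
  shows "continuous_on {0..} \<phi>"
  unfolding continuous_on_eq_continuous_within
proof
  fix x :: real assume x: "x \<in> {0..}"
  show "continuous (at x within {0..}) \<phi>"
  proof (cases "x = 0")
    case False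
    have "continuous_on {0<..} \<phi>"
      by (rule convex_on_continuous)
        (auto intro: convex_on_subset[OF orlicz_Phi_convex[OF assms]])
    with False x show ?thesis
      by (auto simp: continuous_on_eq_continuous_at intro: continuous_at_imp_continuous_at_within)
  next
    case True
    have "(\<phi> \<longlongrightarrow> 0) (at 0 within {0..})"
    proof (rule tendsto_sandwich[of "\<lambda>_. 0" _ _ "\<lambda>x. x"])
      show "\<forall>\<^sub>F x in at 0 within {0..}. 0 \<le> \<phi> x"
        by (auto simp: eventually_at_filter orlicz_Phi_nonneg[OF assms])
      show "\<forall>\<^sub>F x in at 0 within {0..}. \<phi> x \<le> x"
        unfolding eventually_at
        by (rule exI[of _ 1])
          (use orlicz_Phi_scale_le[OF assms, of 1] in \<open>auto simp: orlicz_Phi_one[OF assms]\<close>)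
    qed (auto intro: tendsto_ident_at)
    then show ?thesis
      by (simp add: continuous_within True orlicz_Phi_zero[OF assms])
  qed
qed

text \<open>The slopes of the chords ending at \<open>1\<close> increase and are bounded by the
  slope of the chord from \<open>1\<close> to \<open>2\<close>, so their left limit exists as a
  supremum. The bound \<open>\<phi> t \<le> t\<close> makes these slopes at least \<open>1\<close>,
  so division by the left derivative is legitimate later.\<close>

lemma orlicz_Phi_left_deriv:
  assumes "\<phi> \<in> orlicz_Phi"
  shows "((\<lambda>t. (1 - \<phi> t) / (1 - t)) \<longlongrightarrow> left_deriv \<phi> 1) (at_left 1)"
    and "1 \<le> left_deriv \<phi> 1"
proof -
  define q where "q t = (\<phi> t - \<phi> 1) / (t - 1)" for t
  define D where "D = Sup (q ` ({..<1} \<inter> {0..}))"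
  note slope = convex_on_slope_le[OF orlicz_Phi_convex[OF assms]]
  have "(q \<longlongrightarrow> D) (at 1 within {..<1} \<inter> {0..})"
    unfolding D_def
  proof (rule Lim_left_bound)
    fix a b :: real assume "a \<in> {0..}" "b \<in> {0..}" "b < 1" "a \<le> b"
    then show "q a \<le> q b"
      using slope(2)[of a 1 b] by (cases "a = b") (auto simp: q_def)
  next
    fix a :: real assume "a \<in> {0..}" "a < 1"
    then show "q a \<le> (\<phi> 1 - \<phi> 2) / (1 - 2)"
      using slope[of a 2 1] by (simp add: q_def)
  qed
  \<comment> \<open>Convexity is known on the nonnegative half-line only; near \<open>1\<close> this
    restriction does not change the filter.\<close>
  moreover have "at 1 within {..<1} \<inter> {0..} = at_left (1::real)"
    by (rule at_within_nhd[of _ "{0<..}"]) auto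
  ultimately have lim: "(q \<longlongrightarrow> D) (at_left 1)" by simp
  then have "(\<phi> has_real_derivative D) (at_left 1)"
    by (simp add: has_field_derivative_iff q_def[abs_def])
  moreover have "D' = D" if "(\<phi> has_real_derivative D') (at_left 1)" for D'
    using that lim by (intro tendsto_unique[of "at_left 1" q])
      (simp_all add: has_field_derivative_iff q_def[abs_def])
  ultimately have D: "left_deriv \<phi> 1 = D"
    unfolding left_deriv_def by blast
  have q_eq: "q t = (1 - \<phi> t) / (1 - t)" for t
    unfolding q_def orlicz_Phi_one[OF assms] by (metis minus_diff_eq minus_divide_divide)
  then show "((\<lambda>t. (1 - \<phi> t) / (1 - t)) \<longlongrightarrow> left_deriv \<phi> 1) (at_left 1)"
    using lim by (simp add: D q_eq[abs_def])
  have "\<forall>\<^sub>F t in at_left 1. 1 \<le> q t"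
  proof -
    have "1 \<le> q t" if "t \<in> {0<..<1}" for t
      using orlicz_Phi_scale_le[OF assms, of 1 t] that
      by (simp add: q_eq orlicz_Phi_one[OF assms])
    then show ?thesis
      using eventually_at_left_real[of 0 "1::real"] by (auto elim: eventually_mono)
  qed
  then show "1 \<le> left_deriv \<phi> 1"
    using tendsto_lowerbound[OF lim] by (simp add: D)
qed

subsection \<open>Polar coordinates\<close>

lemma borel_measurable_sgn [measurable]:
  "sgn \<in> borel_measurable (borel :: 'a::{real_normed_vector, second_countable_topology} measure)"
  unfolding sgn_div_norm[abs_def] by measurable

lemma nn_integral_lborel_scaleR:
  fixes f :: "'a::euclidean_space \<Rightarrow> ennreal"
  assumes [measurable]: "f \<in> borel_measurable borel" and r: "0 < r"
  shows "(\<integral>\<^sup>+x. f x \<partial>lborel) = ennreal (r ^ DIM('a)) * (\<integral>\<^sup>+x. f (r *\<^sub>R x) \<partial>lborel)"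
  by (subst lborel_affine[of r 0])
    (use r in \<open>simp_all add: nn_integral_density nn_integral_distr nn_integral_cmult\<close>)

lemma nn_integral_power_Ioc:
  fixes a :: real
  assumes "0 \<le> a" "0 < n"
  shows "(\<integral>\<^sup>+r. ennreal (real n * r ^ (n - 1)) * indicator {0<..a} r \<partial>lborel) = ennreal (a ^ n)"
proof -
  have "(\<integral>\<^sup>+r. ennreal (real n * r ^ (n - 1)) * indicator {0<..a} r \<partial>lborel) =
      (\<integral>\<^sup>+r. ennreal (real n * r ^ (n - 1)) * indicator {0..a} r \<partial>lborel)"
    using AE_lborel_singleton[of "0::real"]
    by (intro nn_integral_cong_AE) (auto simp: indicator_def elim!: eventually_mono)
  also have "\<dots> = ennreal (a ^ n - 0 ^ n)"
    by (rule nn_integral_FTC_Icc) (use assms in \<open>auto intro!: derivative_eq_intros\<close>)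
  finally show ?thesis using assms by simp
qed

text \<open>This is the total weight left over by the substitution \<open>r = norm x * s\<close> in
  \<open>emeasure_radial_set\<close>; being \<open>1\<close>, it leaves exactly the volume.\<close>

lemma nn_integral_inverse_power_Ioi:
  assumes "0 < n"
  shows "(\<integral>\<^sup>+s. ennreal (real n / s ^ Suc n) * indicator {1<..} s \<partial>lborel) = 1"
proof -
  have "(\<integral>\<^sup>+s. ennreal (real n / s ^ Suc n) * indicator {1<..} s \<partial>lborel) =
      (\<integral>\<^sup>+s. ennreal (real n / s ^ Suc n) * indicator {1..} s \<partial>lborel)"
    using AE_lborel_singleton[of "1::real"]
    by (intro nn_integral_cong_AE) (auto simp: indicator_def elim!: eventually_mono)
  also have "\<dots> = ennreal (0 - (- (1 / 1 ^ n)))"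
  proof (rule nn_integral_FTC_atLeast[where F = "\<lambda>s. - (1 / s ^ n)"])
    show "((\<lambda>s. - (1 / s ^ n) :: real) has_real_derivative real n / s ^ Suc n) (at s)" if "1 \<le> s" for s :: real
      using that power_minus_mult[of n s] assms
      by (auto intro!: derivative_eq_intros simp: field_simps simp del: power_minus_mult)
    have "filterlim (\<lambda>s::real. s ^ n) at_top at_top"
      using assms by (intro filterlim_pow_at_top filterlim_ident)
    then show "((\<lambda>s. - (1 / s ^ n) :: real) \<longlongrightarrow> 0) at_top"
      using tendsto_minus[OF tendsto_divide_0[OF tendsto_const[of 1] filterlim_at_top_imp_at_infinity]]
      by simp
  qed auto
  finally show ?thesis by simp
qed

text \<open>Both sides are obtained by integrating \<open>DIM('a) / r\<close> over the set of all \<open>(x, r)\<close> with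
  \<open>\<bar>x\<bar> < r \<le> h (sgn x)\<close>: substitute \<open>r = \<bar>x\<bar> s\<close> for fixed \<open>x\<close>, respectively \<open>x = r y\<close> for
  fixed \<open>r\<close>.\<close>

lemma emeasure_radial_set:
  fixes h :: "'a::euclidean_space \<Rightarrow> real"
  assumes [measurable]: "h \<in> borel_measurable borel" and h: "\<And>u. 0 \<le> h u"
  shows "emeasure lborel {x. x \<noteq> 0 \<and> norm x \<le> h (sgn x)} =
    (\<integral>\<^sup>+x. ennreal (h (sgn x) ^ DIM('a)) * indicator (ball 0 1 - {0}) x \<partial>lborel)"
proof -
  let ?N = "DIM('a)"
  define E where "E = {x. x \<noteq> 0 \<and> norm x \<le> h (sgn x)}"
  have E[measurable]: "E \<in> sets borel" unfolding E_def by measurable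
  define f where "f x r = (if x \<noteq> 0 \<and> norm x < r \<and> r \<le> h (sgn x) then ennreal (?N / r) else 0)" for x r
  have f[measurable]: "(\<lambda>p. f (fst p) (snd p)) \<in> borel_measurable (borel \<Otimes>\<^sub>M borel)"
    unfolding f_def by measurable
  have "(\<integral>\<^sup>+x. (\<integral>\<^sup>+r. f x r \<partial>lborel) \<partial>lborel) =
      (\<integral>\<^sup>+x. (\<integral>\<^sup>+s. ennreal (?N / s) * indicator {1<..} s * indicator E (s *\<^sub>R x) \<partial>lborel) \<partial>lborel)"
  proof (rule nn_integral_cong)
    fix x :: 'a
    show "(\<integral>\<^sup>+r. f x r \<partial>lborel) =
        (\<integral>\<^sup>+s. ennreal (?N / s) * indicator {1<..} s * indicator E (s *\<^sub>R x) \<partial>lborel)"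
    proof (cases "x = 0")
      case False
      have [measurable]: "f x \<in> borel_measurable borel"
        unfolding f_def by measurable
      have "(\<integral>\<^sup>+r. f x r \<partial>lborel) = ennreal (norm x) * (\<integral>\<^sup>+s. f x (norm x * s) \<partial>lborel)"
        using nn_integral_real_affine[of "f x" "norm x" 0] False by simp
      also have "\<dots> = (\<integral>\<^sup>+s. ennreal (norm x) * f x (norm x * s) \<partial>lborel)"
        by (rule nn_integral_cmult[symmetric]) simp
      also have "\<dots> = (\<integral>\<^sup>+s. ennreal (?N / s) * indicator {1<..} s * indicator E (s *\<^sub>R x) \<partial>lborel)"
        using False by (intro nn_integral_cong)
          (auto simp: f_def E_def indicator_def sgn_scaleR ennreal_mult'[symmetric] mult.commute)
      finally show ?thesis .
    qed (simp add: f_def E_def)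
  qed
  also have "\<dots> = (\<integral>\<^sup>+s. (\<integral>\<^sup>+x. ennreal (?N / s) * indicator {1<..} s * indicator E (s *\<^sub>R x) \<partial>lborel) \<partial>lborel)"
    by (rule lborel_pair.Fubini') measurable
  \<comment> \<open>For fixed \<open>s\<close> the dilated preimage of \<open>E\<close> has measure
    \<open>emeasure lborel E\<close> divided by \<open>s ^ ?N\<close>, which turns the weight
    \<open>?N / s\<close> into \<open>?N / s ^ Suc ?N\<close>.\<close>
  also have "\<dots> = (\<integral>\<^sup>+s. emeasure lborel E * (ennreal (?N / s ^ Suc ?N) * indicator {1<..} s) \<partial>lborel)"
  proof (rule nn_integral_cong)
    fix s :: real
    show "(\<integral>\<^sup>+x. ennreal (?N / s) * indicator {1<..} s * indicator E (s *\<^sub>R x) \<partial>lborel) =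
        emeasure lborel E * (ennreal (?N / s ^ Suc ?N) * indicator {1<..} s)"
    proof (cases "1 < s")
      case True
      have "emeasure lborel E = ennreal (s ^ ?N) * (\<integral>\<^sup>+x. indicator E (s *\<^sub>R x) \<partial>lborel)"
        using nn_integral_lborel_scaleR[of "indicator E" s] True by simp
      then have "emeasure lborel E * ennreal (?N / s ^ Suc ?N) =
          ennreal (?N / s ^ Suc ?N) * ennreal (s ^ ?N) * (\<integral>\<^sup>+x. indicator E (s *\<^sub>R x) \<partial>lborel)"
        by (simp only: ac_simps)
      also have "ennreal (?N / s ^ Suc ?N) * ennreal (s ^ ?N) = ennreal (?N / s)"
        using True by (simp add: ennreal_mult'[symmetric])
      finally show ?thesis
        using True by (simp add: nn_integral_cmult del: power_Suc)
    qed simp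
  qed
  also have "\<dots> = emeasure lborel E"
    by (subst nn_integral_cmult) (simp_all add: nn_integral_inverse_power_Ioi del: power_Suc)
  finally have 1: "(\<integral>\<^sup>+x. (\<integral>\<^sup>+r. f x r \<partial>lborel) \<partial>lborel) = emeasure lborel E" .
  have "(\<integral>\<^sup>+x. (\<integral>\<^sup>+r. f x r \<partial>lborel) \<partial>lborel) = (\<integral>\<^sup>+r. (\<integral>\<^sup>+x. f x r \<partial>lborel) \<partial>lborel)"
    by (rule lborel_pair.Fubini'[symmetric]) (use f in \<open>simp add: case_prod_beta'\<close>)
  \<comment> \<open>With \<open>x = r y\<close> the condition \<open>norm x < r\<close> says that
    \<open>y\<close> lies in the unit ball, and \<open>sgn\<close> is unchanged. The Jacobian
    \<open>r ^ ?N\<close> turns the weight into the derivative of \<open>r ^ ?N\<close>, so the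
    later integral over \<open>r\<close> gives a power of \<open>h\<close>.\<close>
  also have "\<dots> = (\<integral>\<^sup>+r. (\<integral>\<^sup>+y. indicator (ball 0 1 - {0}) y *
      (ennreal (?N * r ^ (?N - 1)) * indicator {0<..h (sgn y)} r) \<partial>lborel) \<partial>lborel)"
  proof (rule nn_integral_cong)
    fix r :: real
    show "(\<integral>\<^sup>+x. f x r \<partial>lborel) = (\<integral>\<^sup>+y. indicator (ball 0 1 - {0}) y *
      (ennreal (?N * r ^ (?N - 1)) * indicator {0<..h (sgn y)} r) \<partial>lborel)"
    proof (cases "0 < r")
      case True
      have [measurable]: "(\<lambda>x. f x r) \<in> borel_measurable borel"
        unfolding f_def by measurable
      have "ennreal (r ^ ?N) * ennreal (?N / r) = ennreal (?N * r ^ (?N - 1))"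
        using True power_minus_mult[of ?N r]
        by (simp add: ennreal_mult'[symmetric] field_simps del: power_minus_mult)
      then have *: "ennreal (r ^ ?N) * f (r *\<^sub>R y) r = indicator (ball 0 1 - {0}) y *
          (ennreal (?N * r ^ (?N - 1)) * indicator {0<..h (sgn y)} r)" for y
        using True by (auto simp: f_def indicator_def sgn_scaleR)
      have "(\<integral>\<^sup>+x. f x r \<partial>lborel) = ennreal (r ^ ?N) * (\<integral>\<^sup>+x. f (r *\<^sub>R x) r \<partial>lborel)"
        by (rule nn_integral_lborel_scaleR[OF _ True]) measurable
      also have "\<dots> = (\<integral>\<^sup>+x. ennreal (r ^ ?N) * f (r *\<^sub>R x) r \<partial>lborel)"
        by (rule nn_integral_cmult[symmetric]) simp
      finally show ?thesis
        by (simp only: *)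
    next
      case False
      then have "f x r = 0" for x
        using le_less_trans[OF norm_ge_zero, of x r] by (auto simp: f_def)
      with False show ?thesis by simp
    qed
  qed
  also have "\<dots> = (\<integral>\<^sup>+y. (\<integral>\<^sup>+r. indicator (ball 0 1 - {0}) y *
      (ennreal (?N * r ^ (?N - 1)) * indicator {0<..h (sgn y)} r) \<partial>lborel) \<partial>lborel)"
    by (rule lborel_pair.Fubini'[symmetric]) (simp add: indicator_def, measurable)
  also have "\<dots> = (\<integral>\<^sup>+y. ennreal (h (sgn y) ^ ?N) * indicator (ball 0 1 - {0}) y \<partial>lborel)"
    by (intro nn_integral_cong)
      (subst nn_integral_cmult, simp, subst nn_integral_power_Ioc, simp_all add: h mult.commute)
  finally show ?thesis using 1 by (simp add: E_def)
qed

text \<open>The spherical measure is a scaled pushforward under \<open>sgn\<close>, so this is the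
  transformation rule for image measures. The right-hand side has the shape produced by
  \<open>emeasure_radial_set\<close>.\<close>

lemma nn_integral_sphere_measure:
  fixes f :: "real ^ 'n::finite \<Rightarrow> ennreal"
  assumes [measurable]: "f \<in> borel_measurable (restrict_space borel (sphere 0 1))"
  shows "(\<integral>\<^sup>+u. f u \<partial>sphere_measure) =
    of_nat CARD('n) * (\<integral>\<^sup>+x. f (sgn x) * indicator (ball 0 1 - {0}) x \<partial>lborel)"
proof -
  have [measurable]: "sgn \<in> restrict_space lborel (ball 0 1 - {0}) \<rightarrow>\<^sub>M
      restrict_space borel (sphere 0 1 :: (real ^ 'n) set)"
    by (rule measurable_restrict_space2)
      (auto simp: space_restrict_space norm_sgn intro: measurable_restrict_space1)
  show ?thesis
    unfolding sphere_measure_def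
    by (simp add: nn_integral_scale_measure nn_integral_distr nn_integral_restrict_space)
qed

lemma sets_sphere_measure [measurable_cong]:
  "sets (sphere_measure :: (real ^ 'n::finite) measure) = sets (restrict_space borel (sphere 0 1))"
  by (simp add: sphere_measure_def)

lemma space_sphere_measure: "space (sphere_measure :: (real ^ 'n::finite) measure) = sphere 0 1"
  using sets_eq_imp_space_eq[OF sets_sphere_measure] by (simp add: space_restrict_space)

text \<open>The total mass is the dimension times the volume of the punctured unit ball. Finiteness
  makes continuous functions on the sphere integrable, since they are bounded.\<close>

lemma finite_sphere_measure: "finite_measure (sphere_measure :: (real ^ 'n::finite) measure)"
proof
  have "emeasure sphere_measure (space (sphere_measure :: (real ^ 'n) measure)) =
      (\<integral>\<^sup>+u. 1 \<partial>(sphere_measure :: (real ^ 'n) measure))"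
    by simp
  also have "\<dots> = of_nat CARD('n) * emeasure lborel (ball 0 1 - {0} :: (real ^ 'n) set)"
    by (subst nn_integral_sphere_measure) simp_all
  also have "\<dots> \<le> of_nat CARD('n) * emeasure lborel (ball 0 1 :: (real ^ 'n) set)"
    by (intro mult_left_mono emeasure_mono) auto
  also have "\<dots> < \<infinity>"
    using emeasure_lborel_ball_finite[of "0 :: real ^ 'n" 1]
    by (simp add: ennreal_mult_less_top of_nat_less_top)
  finally show "emeasure sphere_measure (space (sphere_measure :: (real ^ 'n) measure)) \<noteq> \<infinity>"
    by simp
qed

lemma borel_measurable_sphere_continuous:
  fixes f :: "real ^ 'n::finite \<Rightarrow> real"
  assumes "continuous_on (sphere 0 1) f"
  shows "f \<in> borel_measurable sphere_measure"
  using borel_measurable_continuous_on_restrict[OF assms]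
  by (simp cong: measurable_cong_sets add: sets_sphere_measure)

lemma integrable_sphere_continuous:
  fixes f :: "real ^ 'n::finite \<Rightarrow> real"
  assumes "continuous_on (sphere 0 1) f"
  shows "integrable sphere_measure f"
proof -
  have "compact (f ` sphere 0 1)"
    by (rule compact_continuous_image[OF assms]) simp
  then obtain B where "\<And>u. u \<in> sphere 0 1 \<Longrightarrow> norm (f u) \<le> B"
    using compact_imp_bounded by (fastforce simp: bounded_iff)
  then have "AE u in sphere_measure. norm (f u) \<le> B"
    by (intro AE_I2) (simp add: space_sphere_measure)
  then show ?thesis
    using finite_measure.integrable_const_bound[OF finite_sphere_measure]
      borel_measurable_sphere_continuous[OF assms] by blast
qed

lemma vol_star_body:
  fixes M :: "(real ^ 'n::finite) set"
  assumes M: "star_body M"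
  shows "vol M = (\<integral>u. radial M u ^ CARD('n) \<partial>sphere_measure) / real CARD('n)"
proof -
  note cont = star_body_continuous_radial[OF M]
  \<comment> \<open>\<open>emeasure_radial_set\<close> asks for a function that is measurable and
    nonnegative on the whole space, while \<open>radial M\<close> is controlled only on the sphere;
    hence the extension by zero.\<close>
  define h where "h u = indicator (sphere 0 1) u *\<^sub>R radial M u" for u
  have [measurable]: "h \<in> borel_measurable borel"
    unfolding h_def by (rule borel_measurable_continuous_on_indicator[OF _ cont]) simp
  have h: "0 \<le> h u" for u
    using star_body_radial_pos[OF M, of u] by (auto simp: h_def indicator_def)
  have h_sgn: "h (sgn x) = radial M (sgn x)" if "x \<noteq> 0" for x
    using that by (simp add: h_def norm_sgn)
  have cont_pow: "continuous_on (sphere 0 1) (\<lambda>u. radial M u ^ CARD('n))"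
    by (intro continuous_intros cont)
  have "M = insert 0 {x. x \<noteq> 0 \<and> norm x \<le> radial M (sgn x)}"
    by (rule star_body_eq_radial[OF M])
  also have "{x. x \<noteq> 0 \<and> norm x \<le> radial M (sgn x)} = {x. x \<noteq> 0 \<and> norm x \<le> h (sgn x)}" (is "_ = ?E")
    using h_sgn by auto
  finally have "M = insert 0 ?E" .
  moreover have "emeasure lborel (insert 0 ?E) = emeasure lborel ?E"
    using emeasure_Un_null_set[of ?E lborel "{0}"] countable_imp_null_set_lborel[of "{0}"] by simp
  ultimately have "emeasure lborel M = emeasure lborel ?E" by simp
  also have "\<dots> = (\<integral>\<^sup>+x. ennreal (h (sgn x) ^ CARD('n)) * indicator (ball 0 1 - {0}) x \<partial>lborel)"
    using emeasure_radial_set[of h] h by simp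
  also have "\<dots> = (\<integral>\<^sup>+x. ennreal (radial M (sgn x) ^ CARD('n)) * indicator (ball 0 1 - {0}) x \<partial>lborel)"
    by (intro nn_integral_cong) (auto simp: indicator_def h_sgn)
  finally have "of_nat CARD('n) * emeasure lborel M = (\<integral>\<^sup>+u. ennreal (radial M u ^ CARD('n)) \<partial>sphere_measure)"
    using borel_measurable_continuous_on_restrict[OF cont_pow]
    by (subst nn_integral_sphere_measure) auto
  also have "\<dots> = ennreal (\<integral>u. radial M u ^ CARD('n) \<partial>sphere_measure)"
    using star_body_radial_pos[OF M]
    by (intro nn_integral_eq_integral integrable_sphere_continuous[OF cont_pow] AE_I2)
      (auto simp: space_sphere_measure less_imp_le)
  finally have "of_nat CARD('n) * emeasure lborel M = ennreal (\<integral>u. radial M u ^ CARD('n) \<partial>sphere_measure)" .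
  then have "enn2real (of_nat CARD('n) * emeasure lborel M) =
      (\<integral>u. radial M u ^ CARD('n) \<partial>sphere_measure)"
    using star_body_radial_pos[OF M]
    by (simp only:, intro enn2real_ennreal integral_nonneg_AE AE_I2)
      (auto simp: space_sphere_measure less_imp_le)
  then have "real CARD('n) * measure lborel M = (\<integral>u. radial M u ^ CARD('n) \<partial>sphere_measure)"
    by (simp add: enn2real_mult measure_def)
  \<comment> \<open>A compact set is Borel, so passing to the completion does not change its
    measure.\<close>
  moreover have "vol M = measure lborel M"
    using star_body_compact[OF M] by (simp add: borel_compact measure_completion)
  ultimately show ?thesis by (simp add: field_simps)
qed

subsection \<open>The Orlicz combination\<close>

context
  fixes \<phi>1 \<phi>2 :: "real \<Rightarrow> real" and \<epsilon> :: real
  assumes \<phi>1: "\<phi>1 \<in> orlicz_Phi" and \<phi>2: "\<phi>2 \<in> orlicz_Phi" and \<epsilon>: "0 < \<epsilon>"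
begin

lemma orlicz_sum_strict_mono:
  assumes "0 < a" "0 < b" "0 \<le> s" "s < s'"
  shows "\<phi>1 (a * s) + \<epsilon> * \<phi>2 (b * s) < \<phi>1 (a * s') + \<epsilon> * \<phi>2 (b * s')"
  using assms \<epsilon> by (intro add_strict_mono mult_strict_left_mono orlicz_Phi_less[OF \<phi>1] orlicz_Phi_less[OF \<phi>2]) auto

lemma orlicz_sum_inj:
  assumes "0 < a" "0 < b" "0 \<le> s" "0 \<le> s'"
    and "\<phi>1 (a * s) + \<epsilon> * \<phi>2 (b * s) = \<phi>1 (a * s') + \<epsilon> * \<phi>2 (b * s')"
  shows "s = s'"
  using orlicz_sum_strict_mono[OF assms(1,2), of s s'] orlicz_sum_strict_mono[OF assms(1,2), of s' s] assms
  by (cases s s' rule: linorder_cases) auto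

text \<open>The intermediate value theorem applies on the interval from \<open>0\<close> to
  \<open>1 / a\<close>: the sum vanishes at \<open>0\<close>, and at \<open>1 / a\<close> its first
  term alone is already \<open>1\<close>.\<close>

lemma orlicz_sum_solution:
  assumes "0 < a" "0 < b"
  shows "\<exists>s>0. \<phi>1 (a * s) + \<epsilon> * \<phi>2 (b * s) = 1"
proof -
  let ?G = "\<lambda>s. \<phi>1 (a * s) + \<epsilon> * \<phi>2 (b * s)"
  have "continuous_on {0..1 / a} ?G"
    using assms
    by (intro continuous_intros continuous_on_compose2[OF orlicz_Phi_continuous[OF \<phi>1]]
        continuous_on_compose2[OF orlicz_Phi_continuous[OF \<phi>2]]) auto
  moreover have "?G 0 \<le> 1" "1 \<le> ?G (1 / a)"
    using assms \<epsilon> orlicz_Phi_nonneg[OF \<phi>2, of "b / a"]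
    by (simp_all add: orlicz_Phi_zero[OF \<phi>1] orlicz_Phi_zero[OF \<phi>2] orlicz_Phi_one[OF \<phi>1])
  ultimately obtain s where s: "0 \<le> s" "?G s = 1"
    using IVT'[of ?G 0 1 "1 / a"] assms by auto
  moreover have "s \<noteq> 0"
    using s by (auto simp: orlicz_Phi_zero[OF \<phi>1] orlicz_Phi_zero[OF \<phi>2])
  ultimately show ?thesis by (intro exI[of _ s]) auto
qed

text \<open>Strict monotonicity replaces an implicit function theorem. If \<open>l\<close> lies
  strictly on one side of \<open>s u\<close>, the sum at \<open>l\<close> lies strictly on the same
  side of \<open>1\<close>; continuity in the point preserves this nearby, which keeps the solution
  on the other side of \<open>l\<close>.\<close>

lemma orlicz_sum_solution_continuous:
  fixes a b s :: "'a::topological_space \<Rightarrow> real"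
  assumes a: "continuous_on S a" "\<And>u. u \<in> S \<Longrightarrow> 0 < a u"
    and b: "continuous_on S b" "\<And>u. u \<in> S \<Longrightarrow> 0 < b u"
    and s: "\<And>u. u \<in> S \<Longrightarrow> 0 < s u" "\<And>u. u \<in> S \<Longrightarrow> \<phi>1 (a u * s u) + \<epsilon> * \<phi>2 (b u * s u) = 1"
  shows "continuous_on S s"
  unfolding continuous_on_def
proof
  fix u assume u: "u \<in> S"
  define G where "G r v = \<phi>1 (a v * r) + \<epsilon> * \<phi>2 (b v * r)" for r v
  have S: "\<forall>\<^sub>F v in at u within S. v \<in> S"
    by (simp add: eventually_at_topological) blast
  have lim: "(G r \<longlongrightarrow> G r u) (at u within S)" if r: "0 \<le> r" for r
  proof -
    have "continuous_on S (G r)"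
      unfolding G_def using r a(2) b(2)
      by (intro continuous_intros a(1) b(1) continuous_on_compose2[OF orlicz_Phi_continuous[OF \<phi>1]]
        continuous_on_compose2[OF orlicz_Phi_continuous[OF \<phi>2]]) (auto simp: less_imp_le)
    with u show ?thesis by (simp add: continuous_on_def)
  qed
  have G_less: "G r v < G r' v" if "v \<in> S" "0 \<le> r" "r < r'" for r r' v
    unfolding G_def using that a(2) b(2) by (intro orlicz_sum_strict_mono) auto
  have G_s: "G (s v) v = 1" if "v \<in> S" for v
    using s(2)[OF that] by (simp add: G_def)
  show "(s \<longlongrightarrow> s u) (at u within S)"
  proof (rule order_tendstoI)
    fix l assume l: "l < s u"
    show "\<forall>\<^sub>F v in at u within S. l < s v"
    proof (cases "l \<le> 0")
      case True
      show ?thesis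
        using S by eventually_elim (use True s(1) in force)
    next
      case False
      then have "\<forall>\<^sub>F v in at u within S. G l v < 1"
        using order_tendstoD(2)[OF lim] G_less[OF u _ l] G_s[OF u] by auto
      with S show ?thesis
      proof eventually_elim
        case (elim v)
        show ?case
        proof (rule ccontr)
          assume "\<not> l < s v"
          with G_less[OF \<open>v \<in> S\<close>, of "s v" l] s(1)[OF \<open>v \<in> S\<close>] G_s[OF \<open>v \<in> S\<close>] elim
          show False by (cases "l = s v") auto
        qed
      qed
    qed
  next
    fix l assume l: "s u < l"
    have "0 < l" using l s(1)[OF u] by simp
    then have "\<forall>\<^sub>F v in at u within S. 1 < G l v"
      using order_tendstoD(1)[OF lim] G_less[OF u _ l] G_s[OF u] s(1)[OF u] by auto
    with S show "\<forall>\<^sub>F v in at u within S. s v < l"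
    proof eventually_elim
      case (elim v)
      show ?case
      proof (rule ccontr)
        assume "\<not> s v < l"
        with G_less[OF \<open>v \<in> S\<close>, of l "s v"] \<open>0 < l\<close> G_s[OF \<open>v \<in> S\<close>] elim
        show False by (cases "l = s v") auto
      qed
    qed
  qed
qed

text \<open>In the variable \<open>s = 1 / radial M u ^ CARD('n)\<close> the condition is a scalar
  equation in each direction. Its unique solutions vary continuously, hence come from exactly one
  star body.\<close>

lemma orlicz_comb:
  fixes K L :: "(real ^ 'n::finite) set"
  assumes K: "star_body K" and L: "star_body L" and k: "0 < k1" "0 < k2" "0 < k"
  defines "M \<equiv> orlicz_comb \<phi>1 \<phi>2 k1 k2 k \<epsilon> K L"
  shows star_body_orlicz_comb: "star_body M"
    and radial_orlicz_comb: "norm u = 1 \<Longrightarrow>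
      \<phi>1 (k1 * radial K u ^ CARD('n) / (k * radial M u ^ CARD('n))) +
      \<epsilon> * \<phi>2 (k2 * radial L u ^ CARD('n) / (k * radial M u ^ CARD('n))) = 1"
proof -
  let ?S = "sphere 0 1 :: (real ^ 'n) set"
  define a where "a u = k1 * radial K u ^ CARD('n) / k" for u
  define b where "b u = k2 * radial L u ^ CARD('n) / k" for u
  have a: "0 < a u" and b: "0 < b u" if "norm u = 1" for u
    using star_body_radial_pos[OF K that] star_body_radial_pos[OF L that] k by (auto simp: a_def b_def)
  have contab: "continuous_on ?S a" "continuous_on ?S b"
    unfolding a_def b_def using k
    by (auto intro!: continuous_intros star_body_continuous_radial[OF K] star_body_continuous_radial[OF L])
  \<comment> \<open>\<open>P\<close> repeats the predicate of the definite description verbatim, so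
    that \<open>THE M. P M\<close> is the combination itself; \<open>P_iff\<close> isolates the
    scalar unknown.\<close>
  define P where "P M \<longleftrightarrow> star_body M \<and> (\<forall>u\<in>?S.
      \<phi>1 (k1 * radial K u ^ CARD('n) / (k * radial M u ^ CARD('n))) +
      \<epsilon> * \<phi>2 (k2 * radial L u ^ CARD('n) / (k * radial M u ^ CARD('n))) = 1)" for M
  have P_iff: "P M \<longleftrightarrow> star_body M \<and> (\<forall>u\<in>?S.
      \<phi>1 (a u * (1 / radial M u ^ CARD('n))) + \<epsilon> * \<phi>2 (b u * (1 / radial M u ^ CARD('n))) = 1)" for M
    by (simp add: P_def a_def b_def)
  have "\<forall>u\<in>?S. \<exists>s>0. \<phi>1 (a u * s) + \<epsilon> * \<phi>2 (b u * s) = 1"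
    using orlicz_sum_solution a b by simp
  then obtain s where s: "\<And>u. u \<in> ?S \<Longrightarrow> 0 < s u"
      "\<And>u. u \<in> ?S \<Longrightarrow> \<phi>1 (a u * s u) + \<epsilon> * \<phi>2 (b u * s u) = 1"
    by metis
  have "continuous_on ?S s"
    using orlicz_sum_solution_continuous[OF contab(1) _ contab(2) _ s] a b by simp
  then have "continuous_on ?S (\<lambda>u. root CARD('n) (1 / s u))"
    using s(1) by (intro continuous_intros) force+
  moreover have "0 < root CARD('n) (1 / s u)" if "norm u = 1" for u
    using s(1)[of u] that by simp
  ultimately obtain M0 where M0: "star_body M0" "\<And>u. norm u = 1 \<Longrightarrow> radial M0 u = root CARD('n) (1 / s u)"
    using star_body_exists by blast
  have "1 / radial M0 u ^ CARD('n) = s u" if "norm u = 1" for u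
    using s(1)[of u] that by (simp add: M0(2) real_root_pow_pos2)
  then have "P M0"
    unfolding P_iff using M0(1) s(2) by simp
  moreover have "M1 = M2" if "P M1" "P M2" for M1 M2
  proof (rule star_body_eqI)
    fix u :: "real ^ 'n" assume u: "norm u = 1"
    have pos: "0 < radial M1 u" "0 < radial M2 u"
      using that star_body_radial_pos[OF _ u] unfolding P_def by blast+
    have "1 / radial M1 u ^ CARD('n) = 1 / radial M2 u ^ CARD('n)"
    proof (rule orlicz_sum_inj[OF a[OF u] b[OF u]])
      have "\<phi>1 (a u * (1 / radial M u ^ CARD('n))) + \<epsilon> * \<phi>2 (b u * (1 / radial M u ^ CARD('n))) = 1"
        if "P M" for M
        using that u unfolding P_iff by simp
      from this[OF that(1)] this[OF that(2)]
      show "\<phi>1 (a u * (1 / radial M1 u ^ CARD('n))) + \<epsilon> * \<phi>2 (b u * (1 / radial M1 u ^ CARD('n))) =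
          \<phi>1 (a u * (1 / radial M2 u ^ CARD('n))) + \<epsilon> * \<phi>2 (b u * (1 / radial M2 u ^ CARD('n)))"
        by (rule trans[OF _ sym])
    qed (use pos in auto)
    then have "radial M1 u ^ CARD('n) = radial M2 u ^ CARD('n)" by simp
    then show "radial M1 u = radial M2 u"
      by (rule power_eq_imp_eq_base) (use pos in simp_all)
  qed (use that in \<open>auto simp: P_def\<close>)
  ultimately have "\<exists>!M. P M" by blast
  then have "P (THE M. P M)" by (rule theI')
  moreover have "(THE M. P M) = M"
    unfolding M_def orlicz_comb_def P_def by simp
  ultimately have "P M" by simp
  then show "star_body M" and "norm u = 1 \<Longrightarrow>
      \<phi>1 (k1 * radial K u ^ CARD('n) / (k * radial M u ^ CARD('n))) +
      \<epsilon> * \<phi>2 (k2 * radial L u ^ CARD('n) / (k * radial M u ^ CARD('n))) = 1"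
    by (auto simp: P_def)
qed

text \<open>By convexity \<open>1 - t \<le> 1 - \<phi>1 t = \<epsilon> * \<phi>2 (c * t) \<le> \<epsilon> * \<phi>2 c * t\<close>.\<close>

lemma orlicz_quotient_bounds:
  assumes c: "0 < c" and t: "0 < t" and eq: "\<phi>1 t + \<epsilon> * \<phi>2 (c * t) = 1"
  shows "t < 1" and "1 - t \<le> \<epsilon> * \<phi>2 c" and "0 \<le> (1 / t - 1) / \<epsilon>" and "(1 / t - 1) / \<epsilon> \<le> \<phi>2 c"
proof -
  have "0 < \<phi>2 (c * t)"
    using orlicz_Phi_less[OF \<phi>2, of 0 "c * t"] c t by (simp add: orlicz_Phi_zero[OF \<phi>2])
  from mult_pos_pos[OF \<epsilon> this] eq have "\<phi>1 t < \<phi>1 1"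
    unfolding orlicz_Phi_one[OF \<phi>1] by linarith
  then show t1: "t < 1"
    using orlicz_Phi_mono[OF \<phi>1, of 1 t] by force
  have "1 - t \<le> 1 - \<phi>1 t"
    using orlicz_Phi_scale_le[OF \<phi>1, of 1 t] t t1 by (simp add: orlicz_Phi_one[OF \<phi>1])
  also have "\<dots> = \<epsilon> * \<phi>2 (c * t)" using eq by simp
  also have "\<dots> \<le> \<epsilon> * (\<phi>2 c * t)"
    using orlicz_Phi_scale_le[OF \<phi>2, of c t] c t t1 \<epsilon> by simp
  finally have *: "1 - t \<le> \<epsilon> * (\<phi>2 c * t)" .
  also have "\<dots> \<le> \<epsilon> * \<phi>2 c"
    using orlicz_Phi_nonneg[OF \<phi>2, of c] c t t1 \<epsilon> by (simp add: mult_left_le)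
  finally show "1 - t \<le> \<epsilon> * \<phi>2 c" .
  show "0 \<le> (1 / t - 1) / \<epsilon>" using t t1 \<epsilon> by simp
  show "(1 / t - 1) / \<epsilon> \<le> \<phi>2 c"
    using * t \<epsilon> by (simp add: field_simps)
qed

end

text \<open>The equation expresses \<epsilon> as \<open>(1 - \<phi>1 t) / \<phi>2 (c * t)\<close>,
  so the difference quotient becomes a combination of the chord slope of \<open>\<phi>1\<close> at
  \<open>1\<close>, the value \<open>\<phi>2 (c * t)\<close> and \<open>t\<close>, whose limits are
  all available.\<close>

lemma orlicz_quotient_tendsto:
  assumes \<phi>1: "\<phi>1 \<in> orlicz_Phi" and \<phi>2: "\<phi>2 \<in> orlicz_Phi" and c: "0 < c"
    and t: "\<And>\<epsilon>. 0 < \<epsilon> \<Longrightarrow> 0 < t \<epsilon>" "\<And>\<epsilon>. 0 < \<epsilon> \<Longrightarrow> \<phi>1 (t \<epsilon>) + \<epsilon> * \<phi>2 (c * t \<epsilon>) = 1"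
  shows "((\<lambda>\<epsilon>. (1 / t \<epsilon> - 1) / \<epsilon>) \<longlongrightarrow> \<phi>2 c / left_deriv \<phi>1 1) (at_right 0)"
proof -
  note bounds = orlicz_quotient_bounds[OF \<phi>1 \<phi>2 _ c t]
  have pos: "\<forall>\<^sub>F \<epsilon> in at_right 0. 0 < (\<epsilon>::real)"
    by (simp add: eventually_at_right_less)
  have t1: "(t \<longlongrightarrow> 1) (at_right 0)"
  proof (rule tendsto_sandwich)
    have "((\<lambda>\<epsilon>. 1 - \<epsilon> * \<phi>2 c) \<longlongrightarrow> 1 - 0 * \<phi>2 c) (at_right 0)"
      by (intro tendsto_intros)
    then show "((\<lambda>\<epsilon>. 1 - \<epsilon> * \<phi>2 c) \<longlongrightarrow> 1) (at_right 0)" by simp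
    show "\<forall>\<^sub>F \<epsilon> in at_right 0. 1 - \<epsilon> * \<phi>2 c \<le> t \<epsilon>"
      using pos by eventually_elim (use bounds(2) in force)
    show "\<forall>\<^sub>F \<epsilon> in at_right 0. t \<epsilon> \<le> 1"
      using pos by eventually_elim (use bounds(1) in force)
  qed (rule tendsto_const)
  \<comment> \<open>The approach to \<open>1\<close> must be strictly from the left, as the limit of
    the chord slopes is known only along \<open>at_left 1\<close>.\<close>
  moreover have "\<forall>\<^sub>F \<epsilon> in at_right 0. t \<epsilon> < 1"
    using pos by eventually_elim (use bounds(1) in force)
  ultimately have "filterlim t (at_left 1) (at_right 0)"
    by (simp add: filterlim_at eventually_conj_iff) (auto elim: eventually_mono)
  with orlicz_Phi_left_deriv(1)[OF \<phi>1]
  have q: "((\<lambda>\<epsilon>. (1 - \<phi>1 (t \<epsilon>)) / (1 - t \<epsilon>)) \<longlongrightarrow> left_deriv \<phi>1 1) (at_right 0)"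
    by (rule filterlim_compose)
  have "isCont \<phi>2 c"
    using continuous_on_subset[OF orlicz_Phi_continuous[OF \<phi>2], of "{0<..}"] c
    by (simp add: continuous_on_eq_continuous_at subset_eq)
  moreover have "((\<lambda>\<epsilon>. c * t \<epsilon>) \<longlongrightarrow> c) (at_right 0)"
    using tendsto_mult[OF tendsto_const t1, of c] by simp
  ultimately have "((\<lambda>\<epsilon>. \<phi>2 (c * t \<epsilon>)) \<longlongrightarrow> \<phi>2 c) (at_right 0)"
    by (rule isCont_tendsto_compose)
  then have "((\<lambda>\<epsilon>. \<phi>2 (c * t \<epsilon>) / ((1 - \<phi>1 (t \<epsilon>)) / (1 - t \<epsilon>)) / t \<epsilon>) \<longlongrightarrow>
      \<phi>2 c / left_deriv \<phi>1 1 / 1) (at_right 0)"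
    using orlicz_Phi_left_deriv(2)[OF \<phi>1] by (intro tendsto_divide q t1) auto
  moreover have "\<forall>\<^sub>F \<epsilon> in at_right 0.
      \<phi>2 (c * t \<epsilon>) / ((1 - \<phi>1 (t \<epsilon>)) / (1 - t \<epsilon>)) / t \<epsilon> = (1 / t \<epsilon> - 1) / \<epsilon>"
    using pos
  proof eventually_elim
    case (elim \<epsilon>)
    have "0 < \<phi>2 (c * t \<epsilon>)"
      using orlicz_Phi_less[OF \<phi>2, of 0 "c * t \<epsilon>"] c t(1)[OF elim] by (simp add: orlicz_Phi_zero[OF \<phi>2])
    moreover have eq: "1 - \<phi>1 (t \<epsilon>) = \<epsilon> * \<phi>2 (c * t \<epsilon>)"
      using t(2)[OF elim] by simp
    ultimately show ?case
      unfolding eq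
      using t(1)[OF elim] elim bounds(1)[OF elim elim elim] by (simp add: field_simps)
  qed
  ultimately show ?thesis
    using tendsto_cong by force
qed

subsection \<open>The first variation of volume\<close>

text \<open>Quantifying over \<open>l\<close> makes the existence of the one-sided limit part of the
  claim.\<close>

theorem theorem4p3:
  fixes \<phi>1 \<phi>2 :: "real \<Rightarrow> real"
    and K L :: "(real ^ 'n::finite) set"
    and k1 k2 k :: real
  assumes "\<phi>1 \<in> orlicz_Phi" and "\<phi>2 \<in> orlicz_Phi"
    and "star_body K" and "star_body L"
    and "0 < k1" and "0 < k2" and "0 < k"
  shows "\<exists>l. ((\<lambda>\<epsilon>. (k * vol (orlicz_comb \<phi>1 \<phi>2 k1 k2 k \<epsilon> K L) - k1 * vol K) / \<epsilon>) \<longlongrightarrow> l) (at_right 0) \<and>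
             left_deriv \<phi>1 1 / k1 * l =
               1 / real CARD('n) *
               (\<integral>u. \<phi>2 (k2 * radial L u ^ CARD('n) / (k1 * radial K u ^ CARD('n))) *
                     radial K u ^ CARD('n) \<partial>sphere_measure)"
proof -
  let ?n = "CARD('n)"
  let ?D = "left_deriv \<phi>1 1"
  define c where "c u = k2 * radial L u ^ ?n / (k1 * radial K u ^ ?n)" for u
  define w where "w u = k1 * radial K u ^ ?n" for u
  define M where "M \<epsilon> = orlicz_comb \<phi>1 \<phi>2 k1 k2 k \<epsilon> K L" for \<epsilon>
  \<comment> \<open>This normalisation turns the defining equation into the scalar one of
    \<open>orlicz_quotient_tendsto\<close>, with the direction entering only through
    \<open>c u\<close>.\<close>
  define t where "t u \<epsilon> = w u / (k * radial (M \<epsilon>) u ^ ?n)" for u \<epsilon>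
  define g where "g \<epsilon> u = (k * radial (M \<epsilon>) u ^ ?n - w u) / \<epsilon>" for \<epsilon> u
  have M: "star_body (M \<epsilon>)" if "0 < \<epsilon>" for \<epsilon>
    unfolding M_def using that assms by (intro star_body_orlicz_comb)
  have w_pos: "0 < w u" and c_pos: "0 < c u" if "norm u = 1" for u
    using star_body_radial_pos[OF assms(3) that] star_body_radial_pos[OF assms(4) that] assms(5-7)
    by (simp_all add: w_def c_def)
  have t_pos: "0 < t u \<epsilon>" if "norm u = 1" "0 < \<epsilon>" for u \<epsilon>
    using star_body_radial_pos[OF M that(1)] w_pos that assms(7) by (simp add: t_def)
  have t_eq: "\<phi>1 (t u \<epsilon>) + \<epsilon> * \<phi>2 (c u * t u \<epsilon>) = 1" if "norm u = 1" "0 < \<epsilon>" for u \<epsilon>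
  proof -
    have eq: "c u * t u \<epsilon> = k2 * radial L u ^ ?n / (k * radial (M \<epsilon>) u ^ ?n)"
      using star_body_radial_pos[OF assms(3) that(1)] assms(5) by (simp add: c_def t_def w_def)
    show ?thesis
      unfolding eq unfolding t_def w_def M_def
      by (rule radial_orlicz_comb[OF assms(1,2) that(2) assms(3-7) that(1)])
  qed
  have g_eq: "g \<epsilon> u = w u * ((1 / t u \<epsilon> - 1) / \<epsilon>)" if "norm u = 1" "0 < \<epsilon>" for u \<epsilon>
    using w_pos[OF that(1)] star_body_radial_pos[OF M that(1)] that(2)
    by (simp add: g_def t_def field_simps)
  have cont_K: "continuous_on (sphere 0 1) w"
    unfolding w_def by (intro continuous_intros star_body_continuous_radial[OF assms(3)])
  have cont_c: "continuous_on (sphere 0 1) c"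
    unfolding c_def using star_body_radial_pos[OF assms(3)] assms(5)
    by (intro continuous_intros star_body_continuous_radial assms(3,4)) force
  have cont_\<phi>2: "continuous_on (sphere 0 1) (\<lambda>u. \<phi>2 (c u))"
    by (rule continuous_on_compose2[OF orlicz_Phi_continuous[OF assms(2)] cont_c])
      (use c_pos in \<open>force intro: less_imp_le\<close>)
  have cont_M: "continuous_on (sphere 0 1) (\<lambda>u. k * radial (M \<epsilon>) u ^ ?n)" if "0 < \<epsilon>" for \<epsilon>
    by (intro continuous_intros star_body_continuous_radial M that)
  have cont_g: "continuous_on (sphere 0 1) (g \<epsilon>)" if "0 < \<epsilon>" for \<epsilon>
    unfolding g_def using that by (intro continuous_intros cont_K cont_M[OF that]) auto
  have vol_eq: "(k * vol (M \<epsilon>) - k1 * vol K) / \<epsilon> = (\<integral>u. g \<epsilon> u \<partial>sphere_measure) / ?n" if "0 < \<epsilon>" for \<epsilon>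
  proof -
    have "(\<integral>u. g \<epsilon> u \<partial>sphere_measure) =
        ((\<integral>u. k * radial (M \<epsilon>) u ^ ?n \<partial>sphere_measure) - (\<integral>u. w u \<partial>sphere_measure)) / \<epsilon>"
      unfolding g_def
      by (simp only: integral_divide_zero Bochner_Integration.integral_diff[OF
          integrable_sphere_continuous[OF cont_M[OF that]] integrable_sphere_continuous[OF cont_K]])
    then show ?thesis
      by (simp add: vol_star_body[OF M[OF that]] vol_star_body[OF assms(3)] w_def
          diff_divide_distrib mult.commute)
  qed
  have lim: "((\<lambda>\<epsilon>. \<integral>u. g \<epsilon> u \<partial>sphere_measure) \<longlongrightarrow>
      (\<integral>u. w u * (\<phi>2 (c u) / ?D) \<partial>sphere_measure)) (at_right 0)"
    \<comment> \<open>Dominated convergence is applied along sequences, so the one-sided limit is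
      tested on every positive null sequence.\<close>
    unfolding tendsto_at_iff_sequentially o_def
  proof (intro allI impI)
    fix X :: "nat \<Rightarrow> real" assume X: "\<forall>i. X i \<in> {0<..} - {0}" "X \<longlonglongrightarrow> 0"
    then have X_pos: "0 < X i" for i by simp
    have X_lim: "filterlim X (at_right 0) sequentially"
      using X(2) X_pos less_imp_neq[OF X_pos, symmetric] by (simp add: filterlim_at)
    show "(\<lambda>i. \<integral>u. g (X i) u \<partial>sphere_measure) \<longlonglongrightarrow> (\<integral>u. w u * (\<phi>2 (c u) / ?D) \<partial>sphere_measure)"
    proof (rule integral_dominated_convergence)
      \<comment> \<open>The majorant comes from the last bound of
        \<open>orlicz_quotient_bounds\<close>, which is uniform in \<epsilon>; it is continuous on
        the sphere.\<close>
      show "integrable sphere_measure (\<lambda>u. w u * \<phi>2 (c u))"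
        by (intro integrable_sphere_continuous continuous_intros cont_K cont_\<phi>2)
      show "(\<lambda>u. w u * (\<phi>2 (c u) / ?D)) \<in> borel_measurable sphere_measure"
        using orlicz_Phi_left_deriv(2)[OF assms(1)]
        by (intro borel_measurable_sphere_continuous continuous_intros cont_K cont_\<phi>2) auto
      show "g (X i) \<in> borel_measurable sphere_measure" for i
        by (intro borel_measurable_sphere_continuous cont_g X_pos)
      show "AE u in sphere_measure. (\<lambda>i. g (X i) u) \<longlonglongrightarrow> w u * (\<phi>2 (c u) / ?D)"
      proof (rule AE_I2)
        fix u :: "real ^ 'n" assume "u \<in> space sphere_measure"
        then have u: "norm u = 1" by (simp add: space_sphere_measure)
        have "((\<lambda>\<epsilon>. (1 / t u \<epsilon> - 1) / \<epsilon>) \<longlongrightarrow> \<phi>2 (c u) / ?D) (at_right 0)"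
          using assms(1,2) c_pos[OF u] t_pos[OF u] t_eq[OF u] by (rule orlicz_quotient_tendsto)
        from tendsto_mult[OF tendsto_const filterlim_compose[OF this X_lim]]
        show "(\<lambda>i. g (X i) u) \<longlonglongrightarrow> w u * (\<phi>2 (c u) / ?D)"
          unfolding g_eq[OF u X_pos] .
      qed
      show "AE u in sphere_measure. norm (g (X i) u) \<le> w u * \<phi>2 (c u)" for i
      proof (rule AE_I2)
        fix u :: "real ^ 'n" assume "u \<in> space sphere_measure"
        then have u: "norm u = 1" by (simp add: space_sphere_measure)
        note bounds = orlicz_quotient_bounds(3,4)[OF assms(1,2) X_pos c_pos[OF u] t_pos[OF u X_pos] t_eq[OF u X_pos]]
        show "norm (g (X i) u) \<le> w u * \<phi>2 (c u)"
          unfolding g_eq[OF u X_pos] real_norm_def abs_mult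
          using bounds[of i] w_pos[OF u] by (intro mult_mono) auto
      qed
    qed
  qed
  have "((\<lambda>\<epsilon>. (k * vol (M \<epsilon>) - k1 * vol K) / \<epsilon>) \<longlongrightarrow>
      (\<integral>u. w u * (\<phi>2 (c u) / ?D) \<partial>sphere_measure) / ?n) (at_right 0)"
    by (rule Lim_transform_eventually[OF tendsto_divide[OF lim tendsto_const]])
      (auto simp: eventually_at_filter vol_eq)
  moreover have "(\<integral>u. w u * (\<phi>2 (c u) / ?D) \<partial>sphere_measure) =
      k1 / ?D * (\<integral>u. \<phi>2 (c u) * radial K u ^ ?n \<partial>sphere_measure)"
    unfolding integral_mult_right_zero[symmetric]
    by (intro Bochner_Integration.integral_cong) (simp_all add: w_def)
  \<comment> \<open>The factors \<open>k1\<close> and \<open>?D\<close> in the limit cancel against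
    the prefactor of the claim; \<open>?D\<close> is nonzero because it is at least
    \<open>1\<close>.\<close>
  ultimately show ?thesis
    using orlicz_Phi_left_deriv(2)[OF assms(1)] assms(5)
    by (intro exI[of _ "(\<integral>u. w u * (\<phi>2 (c u) / ?D) \<partial>sphere_measure) / ?n"])
      (simp add: M_def c_def)
qed

end
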